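(* The myopic heuristic is a $2$-approximation algorithm for linear decaying stochastic depletion problems: for every linear decaying stochastic depletion problem, every myopic policy $\pi^g$ and every state $s\in\mathcal S$, $$J^*(s)\le 2\,J^{\pi^g}(s).$$
   Context: Linear decaying stochastic depletion problem (clairvoyant form). There are $M$ item types, with at most $\bar x_m\in\mathbb Z_+$ items of type $m$; a finite nonempty set $\mathcal A$ of activities; a horizon $T$ (a positive integer); and, for each $A\in\mathcal A$, a fixed known sequence $P_t(A)=(P_{t,1}(A),\dots,P_{t,M}(A))\in[0,1]^M$, $t=0,1,2,\dots$. The state space is $\mathcal S=\{(x,t): x\in\prod_{m}\{0,\dots,\bar x_m\},\ t\in\{0,\dots,T\}\}$; for $s=(x,t)$ write $x(s)=x$, $t(s)=t$. If activity $A$ is used in state $s=(x,t)$ with $t<T$, a random vector $X_t=(X_{t,m})_m$ of items is depleted, where the $X_{t,m}$ are independent of each other and (given $x$ and $P_t(A)$) of the past, and $X_{t,m}\sim\mathrm{Binomial}(x_m,P_{t,m}(A))$. The next state is $(x-X_t,t+1)$ and the reward earned is $R(s,A)=\sum_m w_{m,t}X_{t,m}$, where for each $m$, $w_{m,t}$ is a non-negative, non-increasing function of $t\in\{0,\dots,T\}$. A policy is a map $\pi:\mathcal S\to\mathcal A$; $J^\pi(s)=E\big[\sum_{t'=t(s)}^{T-1}R(S_{t'},\pi(S_{t'}))\mid S_{t(s)}=s\big]$, where $S_t$ is the state at time $t$ under $\pi$, and $J^*(s)=\max_\pi J^\pi(s)$. A myopic policy $\pi^g$ is any policy with $\pi^g(s)\in\arg\max_{A\in\mathcal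 A}E[R(s,A)]$ for every $s$ with $t(s)<T$. *)

theory Defs
  imports "HOL-Probability.Probability"
begin

text \<open>
  Item types are the indices \<open>m < n_types D\<close>. Item vectors are functions \<open>nat \<Rightarrow> nat\<close>
  that vanish outside this range.
\<close>

record 'a sdp =
  n_types :: nat
  max_items :: "nat \<Rightarrow> nat"
  activities :: "'a set"
  horizon :: nat
  prob :: "nat \<Rightarrow> 'a \<Rightarrow> nat \<Rightarrow> real"  \<comment> \<open>\<open>prob D t A m\<close> is $P_{t,m}(A)$\<close>
  weight :: "nat \<Rightarrow> nat \<Rightarrow> real"  \<comment> \<open>\<open>weight D m t\<close> is $w_{m,t}$\<close>

type_synonym items = "nat \<Rightarrow> nat"
type_synonym state = "items \<times> nat"
type_synonym 'a policy = "state \<Rightarrow> 'a"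

definition linear_decaying_sdp :: "'a sdp \<Rightarrow> bool" where
  "linear_decaying_sdp D \<longleftrightarrow>
     finite (activities D) \<and> activities D \<noteq> {} \<and> horizon D > 0 \<and>
     (\<forall>t. \<forall>A\<in>activities D. \<forall>m<n_types D. prob D t A m \<in> {0..1}) \<and>
     (\<forall>m<n_types D. (\<forall>t\<in>{0..horizon D}. weight D m t \<ge> 0) \<and>
        antimono_on {0..horizon D} (weight D m))"

definition states :: "'a sdp \<Rightarrow> state set" where
  "states D = PiE_dflt {..<n_types D} 0 (\<lambda>m. {0..max_items D m}) \<times> {0..horizon D}"

definition depletion :: "'a sdp \<Rightarrow> state \<Rightarrow> 'a \<Rightarrow> items pmf" where
  "depletion D = (\<lambda>(x, t) A.
     Pi_pmf {..<n_types D} 0 (\<lambda>m. binomial_pmf (x m) (prob D t A m)))"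

definition next_state :: "state \<Rightarrow> items \<Rightarrow> state" where
  "next_state = (\<lambda>(x, t) X. (\<lambda>m. x m - X m, t + 1))"

definition reward :: "'a sdp \<Rightarrow> state \<Rightarrow> items \<Rightarrow> real" where
  "reward D = (\<lambda>(x, t) X. \<Sum>m<n_types D. weight D m t * real (X m))"

definition expected_reward :: "'a sdp \<Rightarrow> state \<Rightarrow> 'a \<Rightarrow> real" where
  "expected_reward D s A = measure_pmf.expectation (depletion D s A) (reward D s)"

definition policies :: "'a sdp \<Rightarrow> 'a policy set" where
  "policies D = states D \<rightarrow>\<^sub>E activities D"

text \<open>
  Joint distribution of the first \<open>n\<close> pairs (current state, items depleted in it)
  when \<open>\<pi>\<close> is followed from \<open>s\<close>.
\<close>

primrec trajectory :: "'a sdp \<Rightarrow> 'a policy \<Rightarrow> nat \<Rightarrow> state \<Rightarrow> (state \<times> items) list pmf" where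
  "trajectory D \<pi> 0 s = return_pmf []"
| "trajectory D \<pi> (Suc n) s =
     bind_pmf (depletion D s (\<pi> s)) (\<lambda>X.
       map_pmf (\<lambda>h. (s, X) # h) (trajectory D \<pi> n (next_state s X)))"

definition J :: "'a sdp \<Rightarrow> 'a policy \<Rightarrow> state \<Rightarrow> real" where
  "J D \<pi> s = measure_pmf.expectation (trajectory D \<pi> (horizon D - snd s) s)
     (\<lambda>h. \<Sum>(s', X)\<leftarrow>h. reward D s' X)"

definition J_opt :: "'a sdp \<Rightarrow> state \<Rightarrow> real" where
  "J_opt D s = Max ((\<lambda>\<pi>. J D \<pi> s) ` policies D)"

definition myopic :: "'a sdp \<Rightarrow> 'a policy \<Rightarrow> bool" where
  "myopic D \<pi> \<longleftrightarrow> \<pi> \<in> policies D \<and>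
     (\<forall>s\<in>states D. snd s < horizon D \<longrightarrow>
        is_arg_max (expected_reward D s) (\<lambda>A. A \<in> activities D) (\<pi> s))"

text \<open>The maximum in \<^const>\<open>J_opt\<close> ranges over a finite nonempty set.\<close>

lemma finite_policies: "finite (activities D) \<Longrightarrow> finite (policies D)"
  by (auto simp: policies_def states_def intro!: finite_PiE finite_cartesian_product finite_PiE_dflt)

lemma policies_nonempty: "activities D \<noteq> {} \<Longrightarrow> policies D \<noteq> {}"
  by (auto simp: policies_def PiE_eq_empty_iff)

end

theory Submission
  imports Defs
begin

text \<open>
  Let $V$ be the value function given by the Bellman recursion (\<open>opt_value\<close> below), which bounds
  the expected reward of every policy from above (\<open>policy_value_le_opt_value\<close>). The argument rests
  on two properties of $V$, for item vectors $y$ and $d$: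
  \<^item> monotonicity (\<open>opt_value_mono\<close>): $V(y,t) \<le> V(y+d,t)$;
  \<^item> extra items are worth at most their present weight (\<open>opt_value_add_le\<close>):
    $V(y+d,t) \<le> V(y,t) + \sum_m w_{m,t} d_m$.

  Both are proved by induction on the remaining time. If the same activity is used in the states
  $(y,t)$ and $(y+d,t)$, the depletions can be coupled: $\mathrm{Binomial}(y_m+d_m,p)$ is the sum of
  independent $\mathrm{Binomial}(y_m,p)$ and $\mathrm{Binomial}(d_m,p)$ variables
  (\<open>depletion_add\<close>), so what remains of $y$ and what remains of $d$ can be followed separately.

  Now let $A$ be an optimal and $G$ a myopic activity in $s=(x,t)$, with depletions $X^A$ and $X^G$.
  Monotonicity, the myopic choice and the second property (together with $w_{m,t+1} \<le> w_{m,t}$)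
  give
  \[ V(s) = E[R(s,A) + V(x-X^A,t+1)] \<le> E[R(s,A)] + V(x,t+1) \<le> E[R(s,G)] + V(x,t+1)
     \<le> E[2R(s,G) + V(x-X^G,t+1)], \]
  and induction on the remaining time shows that $V$ is at most twice the value of the myopic policy
  (\<open>opt_value_le_twice_myopic\<close>).
\<close>

section \<open>Finitely supported expectations\<close>

lemma expectation_mono_finite:
  fixes f g :: "'b \<Rightarrow> real"
  assumes "finite (set_pmf M)" and "\<And>x. x \<in> set_pmf M \<Longrightarrow> f x \<le> g x"
  shows "measure_pmf.expectation M f \<le> measure_pmf.expectation M g"
  using assms
  by (intro integral_mono_AE integrable_measure_pmf_finite) (auto simp: AE_measure_pmf_iff)

lemma expectation_bind_finite:
  fixes h :: "'b \<Rightarrow> real"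
  assumes "finite (set_pmf p)" and "\<And>x. x \<in> set_pmf p \<Longrightarrow> finite (set_pmf (f x))"
  shows "measure_pmf.expectation (bind_pmf p f) h =
    measure_pmf.expectation p (\<lambda>x. measure_pmf.expectation (f x) h)"
  using assms by (subst pmf_expectation_bind[where A = "set_pmf p"])
    (auto simp: integral_measure_pmf[where A = "set_pmf p"])

lemma expectation_pair_fst:
  fixes f :: "'b \<Rightarrow> real"
  shows "measure_pmf.expectation p f = measure_pmf.expectation (pair_pmf p q) (\<lambda>z. f (fst z))"
proof -
  have "measure_pmf.expectation (map_pmf fst (pair_pmf p q)) f =
      measure_pmf.expectation (pair_pmf p q) (\<lambda>z. f (fst z))"
    by (rule integral_map_pmf)
  then show ?thesis by (simp add: map_fst_pair_pmf)
qed

lemma binomial_pmf_add: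
  assumes "p \<in> {0..1}"
  shows "binomial_pmf (m + n) p =
    bind_pmf (binomial_pmf m p) (\<lambda>a. map_pmf (\<lambda>b. a + b) (binomial_pmf n p))"
proof (induction m)
  case 0
  then show ?case using assms by (simp add: binomial_pmf_0 bind_return_pmf map_pmf_def bind_return_pmf')
next
  case (Suc m)
  then show ?case
    using assms
    by (simp add: binomial_pmf_Suc bind_return_pmf bind_assoc_pmf map_pmf_def add.assoc)
qed

section \<open>Depletions\<close>

lemma linear_decaying_prob:
  "linear_decaying_sdp D \<Longrightarrow> A \<in> activities D \<Longrightarrow> m < n_types D \<Longrightarrow> prob D t A m \<in> {0..1}"
  unfolding linear_decaying_sdp_def by blast

lemma set_pmf_depletion:
  assumes "linear_decaying_sdp D" and "A \<in> activities D"
  shows "set_pmf (depletion D (x, t) A) \<subseteq> PiE_dflt {..<n_types D} 0 (\<lambda>m. {..x m})"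
proof -
  have "set_pmf (binomial_pmf (x m) (prob D t A m)) \<subseteq> {..x m}" if "m < n_types D" for m
    using linear_decaying_prob[OF assms that, of t] by (auto simp: set_pmf_binomial_eq split: if_splits)
  then show ?thesis
    unfolding depletion_def by (auto simp: set_Pi_pmf PiE_dflt_def)
qed

lemma depletion_le:
  assumes "linear_decaying_sdp D" and "A \<in> activities D" and "X \<in> set_pmf (depletion D (x, t) A)"
  shows "X m \<le> x m"
  using set_pmf_depletion[OF assms(1,2)] assms(3)
  by (cases "m < n_types D") (force simp: PiE_dflt_def)+

lemma finite_set_depletion:
  assumes "linear_decaying_sdp D" and "A \<in> activities D"
  shows "finite (set_pmf (depletion D s A))"
  using finite_subset[OF set_pmf_depletion[OF assms]]
  by (cases s) (auto intro: finite_PiE_dflt)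

lemma next_state_in_states:
  assumes "s \<in> states D" and "snd s < horizon D"
  shows "next_state s X \<in> states D"
proof -
  obtain x t where s: "s = (x, t)" by (cases s)
  have "x m - X m \<le> max_items D m" if "x m \<le> max_items D m" for m
    using that by linarith
  then show ?thesis
    using assms by (auto simp: s states_def next_state_def PiE_dflt_def)
qed

lemma reward_nonneg:
  assumes "linear_decaying_sdp D" and "t \<le> horizon D"
  shows "reward D (x, t) X \<ge> 0"
  using assms by (auto simp: linear_decaying_sdp_def reward_def intro!: sum_nonneg mult_nonneg_nonneg)

lemma reward_add:
  "reward D (x, t) (\<lambda>m. Y m + Z m) = reward D (y, t) Y + reward D (y, t) Z"
  by (simp add: reward_def algebra_simps sum.distrib)

lemma reward_antimono:
  assumes "linear_decaying_sdp D" and "t < horizon D"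
  shows "reward D (x, t + 1) X \<le> reward D (y, t) X"
  using assms unfolding reward_def linear_decaying_sdp_def
  by (auto intro!: sum_mono mult_right_mono simp: monotone_on_def)

lemma next_state_add:
  assumes "\<And>m. Y m \<le> y m" and "\<And>m. Z m \<le> d m"
  shows "next_state (\<lambda>m. y m + d m, t) (\<lambda>m. Y m + Z m) =
    (\<lambda>m. (y m - Y m) + (d m - Z m), t + 1)"
  using assms by (auto simp: next_state_def fun_eq_iff)

text \<open>
  Coupling: if the same activity is used on two disjoint stocks of items, the depletions of the
  two stocks are independent and add up to the depletion of the joint stock.
\<close>

lemma depletion_add:
  assumes "linear_decaying_sdp D" and "A \<in> activities D"
  shows "depletion D (\<lambda>m. y m + d m, t) A =
    map_pmf (\<lambda>(Y, Z) m. Y m + Z m) (pair_pmf (depletion D (y, t) A) (depletion D (d, t) A))"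
proof -
  let ?I = "{..<n_types D}"
  let ?b = "\<lambda>x m. binomial_pmf (x m) (prob D t A m)"
  have "depletion D (\<lambda>m. y m + d m, t) A = Pi_pmf ?I 0 (\<lambda>m. ?b (\<lambda>m. y m + d m) m)"
    by (simp add: depletion_def)
  also have "\<dots> = Pi_pmf ?I 0 (\<lambda>m. bind_pmf (?b y m) (\<lambda>a. bind_pmf (?b d m) (\<lambda>b. return_pmf (a + b))))"
    by (intro Pi_pmf_cong refl)
      (simp add: binomial_pmf_add[OF linear_decaying_prob[OF assms]] map_pmf_def)
  also have "\<dots> = bind_pmf (Pi_pmf ?I 0 (?b y)) (\<lambda>Y. bind_pmf (Pi_pmf ?I 0 (?b d))
      (\<lambda>Z. return_pmf (\<lambda>m. if m \<in> ?I then Y m + Z m else 0)))"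
    by (simp add: Pi_pmf_bind[where d' = 0])
  also have "\<dots> = bind_pmf (Pi_pmf ?I 0 (?b y)) (\<lambda>Y. bind_pmf (Pi_pmf ?I 0 (?b d))
      (\<lambda>Z. return_pmf (\<lambda>m. Y m + Z m)))"
  proof (intro bind_pmf_cong refl arg_cong[where f = return_pmf] ext)
    fix Y Z m
    assume "Y \<in> set_pmf (Pi_pmf ?I 0 (?b y))" "Z \<in> set_pmf (Pi_pmf ?I 0 (?b d))"
    then show "(if m \<in> ?I then Y m + Z m else 0) = Y m + Z m"
      by (auto simp: set_Pi_pmf PiE_dflt_def)
  qed
  also have "\<dots> = map_pmf (\<lambda>(Y, Z) m. Y m + Z m)
      (pair_pmf (depletion D (y, t) A) (depletion D (d, t) A))"
    by (simp add: depletion_def pair_pmf_def map_pmf_def bind_assoc_pmf bind_return_pmf)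
  finally show ?thesis .
qed

section \<open>Values of policies\<close>

text \<open>
  Expected reward in the first \<open>n\<close> periods when \<open>\<pi>\<close> is followed from \<open>s\<close>. The number of periods
  is a separate argument, rather than the time to the horizon, to serve as the induction variable.
\<close>

definition policy_value :: "'a sdp \<Rightarrow> 'a policy \<Rightarrow> nat \<Rightarrow> state \<Rightarrow> real" where
  "policy_value D \<pi> n s =
     measure_pmf.expectation (trajectory D \<pi> n s) (\<lambda>h. \<Sum>(s', X)\<leftarrow>h. reward D s' X)"

lemma J_eq_policy_value: "J D \<pi> s = policy_value D \<pi> (horizon D - snd s) s"
  by (simp add: J_def policy_value_def)

lemma policy_activity: "\<pi> \<in> policies D \<Longrightarrow> s \<in> states D \<Longrightarrow> \<pi> s \<in> activities D"
  by (auto simp: policies_def)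

lemma finite_set_trajectory:
  assumes "linear_decaying_sdp D" and "\<pi> \<in> policies D"
    and "s \<in> states D" and "snd s + n \<le> horizon D"
  shows "finite (set_pmf (trajectory D \<pi> n s))"
  using assms(3,4)
proof (induction n arbitrary: s)
  case (Suc n)
  have "finite (set_pmf (trajectory D \<pi> n (next_state s X)))" for X
    using Suc.prems
    by (intro Suc.IH next_state_in_states) (auto simp: next_state_def split: prod.splits)
  then show ?case
    using finite_set_depletion[OF assms(1) policy_activity[OF assms(2) Suc.prems(1)], of s] by simp
qed simp

lemma policy_value_0 [simp]: "policy_value D \<pi> 0 s = 0"
  by (simp add: policy_value_def)

lemma policy_value_Suc:
  assumes "linear_decaying_sdp D" and "\<pi> \<in> policies D"
    and "s \<in> states D" and "snd s + Suc n \<le> horizon D"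
  shows "policy_value D \<pi> (Suc n) s =
    measure_pmf.expectation (depletion D s (\<pi> s))
      (\<lambda>X. reward D s X + policy_value D \<pi> n (next_state s X))"
proof -
  have fin: "finite (set_pmf (trajectory D \<pi> n (next_state s X)))" for X
    using assms
    by (intro finite_set_trajectory next_state_in_states)
      (auto simp: next_state_def split: prod.splits)
  note fin_dep = finite_set_depletion[OF assms(1) policy_activity[OF assms(2,3)], of s]
  have "policy_value D \<pi> (Suc n) s = measure_pmf.expectation (depletion D s (\<pi> s))
      (\<lambda>X. measure_pmf.expectation (trajectory D \<pi> n (next_state s X))
        (\<lambda>h. reward D s X + (\<Sum>(s', X)\<leftarrow>h. reward D s' X)))"
    unfolding policy_value_def trajectory.simps
    by (subst expectation_bind_finite[OF fin_dep]) (simp_all add: fin)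
  also have "\<dots> = measure_pmf.expectation (depletion D s (\<pi> s))
      (\<lambda>X. reward D s X + policy_value D \<pi> n (next_state s X))"
    unfolding policy_value_def
    by (subst Bochner_Integration.integral_add)
      (simp_all add: fin integrable_measure_pmf_finite)
  finally show ?thesis .
qed

section \<open>The Bellman value function\<close>

text \<open>
  The value of an optimal choice of activities when \<open>n\<close> periods remain. It is defined for every
  state, without reference to policies and to the bounds on the numbers of items.
\<close>

primrec opt_value :: "'a sdp \<Rightarrow> nat \<Rightarrow> state \<Rightarrow> real" where
  "opt_value D 0 s = 0"
| "opt_value D (Suc n) s =
     (MAX A\<in>activities D. measure_pmf.expectation (depletion D s A)
       (\<lambda>X. reward D s X + opt_value D n (next_state s X)))"

lemma opt_value_Suc_ge:
  assumes "linear_decaying_sdp D" and "A \<in> activities D"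
  shows "measure_pmf.expectation (depletion D s A)
    (\<lambda>X. reward D s X + opt_value D n (next_state s X)) \<le> opt_value D (Suc n) s"
  using assms by (auto simp: linear_decaying_sdp_def intro!: Max_ge)

lemma opt_value_Suc_attained:
  assumes "linear_decaying_sdp D"
  obtains A where "A \<in> activities D" and "opt_value D (Suc n) s =
    measure_pmf.expectation (depletion D s A)
      (\<lambda>X. reward D s X + opt_value D n (next_state s X))"
proof -
  let ?f = "\<lambda>A. measure_pmf.expectation (depletion D s A)
    (\<lambda>X. reward D s X + opt_value D n (next_state s X))"
  have "Max (?f ` activities D) \<in> ?f ` activities D"
    using assms by (intro Max_in) (auto simp: linear_decaying_sdp_def)
  then show ?thesis using that by auto
qed

lemma policy_value_le_opt_value:
  assumes "linear_decaying_sdp D" and "\<pi> \<in> policies D"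
    and "s \<in> states D" and "snd s + n \<le> horizon D"
  shows "policy_value D \<pi> n s \<le> opt_value D n s"
  using assms(3,4)
proof (induction n arbitrary: s)
  case (Suc n)
  note act = policy_activity[OF assms(2) Suc.prems(1)]
  have IH: "policy_value D \<pi> n (next_state s X) \<le> opt_value D n (next_state s X)" for X
    using Suc.prems
    by (intro Suc.IH next_state_in_states) (auto simp: next_state_def split: prod.splits)
  have "policy_value D \<pi> (Suc n) s = measure_pmf.expectation (depletion D s (\<pi> s))
      (\<lambda>X. reward D s X + policy_value D \<pi> n (next_state s X))"
    by (rule policy_value_Suc[OF assms(1,2) Suc.prems])
  also have "\<dots> \<le> measure_pmf.expectation (depletion D s (\<pi> s))
      (\<lambda>X. reward D s X + opt_value D n (next_state s X))"
    by (intro expectation_mono_finite finite_set_depletion assms(1) act add_left_mono IH)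
  also have "\<dots> \<le> opt_value D (Suc n) s"
    by (rule opt_value_Suc_ge[OF assms(1) act])
  finally show ?case .
qed simp

lemma opt_value_mono:
  assumes lin: "linear_decaying_sdp D" and "t + n \<le> horizon D"
  shows "opt_value D n (y, t) \<le> opt_value D n (\<lambda>m. y m + d m, t)"
  using assms(2)
proof (induction n arbitrary: y d t)
  case (Suc n)
  obtain A where A: "A \<in> activities D" and V: "opt_value D (Suc n) (y, t) =
      measure_pmf.expectation (depletion D (y, t) A)
        (\<lambda>X. reward D (y, t) X + opt_value D n (next_state (y, t) X))"
    using opt_value_Suc_attained[OF lin] by blast
  let ?M = "pair_pmf (depletion D (y, t) A) (depletion D (d, t) A)"
  let ?x = "\<lambda>m. y m + d m"
  have "opt_value D (Suc n) (y, t) = measure_pmf.expectation ?M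
      (\<lambda>z. reward D (y, t) (fst z) + opt_value D n (next_state (y, t) (fst z)))"
    unfolding V by (rule expectation_pair_fst)
  also have "\<dots> \<le> measure_pmf.expectation ?M (\<lambda>z. reward D (?x, t) (\<lambda>m. fst z m + snd z m) +
      opt_value D n (next_state (?x, t) (\<lambda>m. fst z m + snd z m)))"
  proof (rule expectation_mono_finite)
    show "finite (set_pmf ?M)" by (simp add: finite_set_depletion[OF lin A])
    fix z assume z: "z \<in> set_pmf ?M"
    have le: "fst z m \<le> y m" "snd z m \<le> d m" for m
      using z depletion_le[OF lin A] by auto
    have "reward D (?x, t) (\<lambda>m. fst z m + snd z m) =
        reward D (y, t) (fst z) + reward D (y, t) (snd z)"
      by (rule reward_add)
    moreover have "reward D (y, t) (snd z) \<ge> 0"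
      using Suc.prems by (intro reward_nonneg lin) simp
    moreover have "next_state (?x, t) (\<lambda>m. fst z m + snd z m) =
        (\<lambda>m. (y m - fst z m) + (d m - snd z m), t + 1)"
      using le by (rule next_state_add)
    moreover have "opt_value D n (next_state (y, t) (fst z)) \<le>
        opt_value D n (\<lambda>m. (y m - fst z m) + (d m - snd z m), t + 1)"
      using Suc.IH[of "t + 1" "\<lambda>m. y m - fst z m"] Suc.prems by (simp add: next_state_def)
    ultimately show "reward D (y, t) (fst z) + opt_value D n (next_state (y, t) (fst z)) \<le>
        reward D (?x, t) (\<lambda>m. fst z m + snd z m) +
        opt_value D n (next_state (?x, t) (\<lambda>m. fst z m + snd z m))"
      by simp
  qed
  also have "\<dots> = measure_pmf.expectation (depletion D (?x, t) A)
      (\<lambda>X. reward D (?x, t) X + opt_value D n (next_state (?x, t) X))"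
    by (simp add: depletion_add[OF lin A] case_prod_unfold)
  also have "\<dots> \<le> opt_value D (Suc n) (?x, t)"
    by (rule opt_value_Suc_ge[OF lin A])
  finally show ?case .
qed simp

text \<open>
  Additional items are worth at most their current weight: each of them is depleted at most once,
  and delaying its depletion does not increase its weight. The last summand is the weight of the
  items \<open>d\<close> at time \<open>t\<close>, written as the reward for depleting all of them.
\<close>

lemma opt_value_add_le:
  assumes lin: "linear_decaying_sdp D" and "t + n \<le> horizon D"
  shows "opt_value D n (\<lambda>m. y m + d m, t) \<le> opt_value D n (y, t) + reward D (y, t) d"
  using assms(2)
proof (induction n arbitrary: y d t)
  case 0
  then show ?case using reward_nonneg[OF lin, of t] by simp
next
  case (Suc n)
  let ?x = "\<lambda>m. y m + d m"
  obtain A where A: "A \<in> activities D" and V: "opt_value D (Suc n) (?x, t) =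
      measure_pmf.expectation (depletion D (?x, t) A)
        (\<lambda>X. reward D (?x, t) X + opt_value D n (next_state (?x, t) X))"
    using opt_value_Suc_attained[OF lin] by blast
  let ?M = "pair_pmf (depletion D (y, t) A) (depletion D (d, t) A)"
  have fin: "finite (set_pmf ?M)" by (simp add: finite_set_depletion[OF lin A])
  have "opt_value D (Suc n) (?x, t) = measure_pmf.expectation ?M
      (\<lambda>z. reward D (?x, t) (\<lambda>m. fst z m + snd z m) +
        opt_value D n (next_state (?x, t) (\<lambda>m. fst z m + snd z m)))"
    unfolding V by (simp add: depletion_add[OF lin A] case_prod_unfold)
  also have "\<dots> \<le> measure_pmf.expectation ?M (\<lambda>z. (reward D (y, t) (fst z) +
      opt_value D n (next_state (y, t) (fst z))) + reward D (y, t) d)"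
  proof (rule expectation_mono_finite[OF fin])
    fix z assume z: "z \<in> set_pmf ?M"
    have le: "fst z m \<le> y m" "snd z m \<le> d m" for m
      using z depletion_le[OF lin A] by auto
    have "reward D (?x, t) (\<lambda>m. fst z m + snd z m) =
        reward D (y, t) (fst z) + reward D (y, t) (snd z)"
      by (rule reward_add)
    moreover have "next_state (?x, t) (\<lambda>m. fst z m + snd z m) =
        (\<lambda>m. (y m - fst z m) + (d m - snd z m), t + 1)"
      using le by (rule next_state_add)
    moreover have "opt_value D n (\<lambda>m. (y m - fst z m) + (d m - snd z m), t + 1) \<le>
        opt_value D n (next_state (y, t) (fst z)) + reward D (y, t + 1) (\<lambda>m. d m - snd z m)"
      using Suc.IH[of "t + 1" "\<lambda>m. y m - fst z m" "\<lambda>m. d m - snd z m"] Suc.prems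
      by (simp add: next_state_def reward_def)
    moreover have "reward D (y, t + 1) (\<lambda>m. d m - snd z m) \<le> reward D (y, t) (\<lambda>m. d m - snd z m)"
      using Suc.prems by (intro reward_antimono lin) simp
    moreover have "reward D (y, t) (\<lambda>m. d m - snd z m) + reward D (y, t) (snd z) = reward D (y, t) d"
      using le(2) by (simp add: reward_def sum.distrib[symmetric] of_nat_diff algebra_simps)
    ultimately show "reward D (?x, t) (\<lambda>m. fst z m + snd z m) +
        opt_value D n (next_state (?x, t) (\<lambda>m. fst z m + snd z m)) \<le>
        (reward D (y, t) (fst z) + opt_value D n (next_state (y, t) (fst z))) + reward D (y, t) d"
      by simp
  qed
  also have "\<dots> = measure_pmf.expectation ?M (\<lambda>z. reward D (y, t) (fst z) +
      opt_value D n (next_state (y, t) (fst z))) + reward D (y, t) d"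
    by (subst Bochner_Integration.integral_add) (simp_all add: integrable_measure_pmf_finite[OF fin])
  also have "\<dots> = measure_pmf.expectation (depletion D (y, t) A)
      (\<lambda>X. reward D (y, t) X + opt_value D n (next_state (y, t) X)) + reward D (y, t) d"
    by (subst (2) expectation_pair_fst[where q = "depletion D (d, t) A"]) (rule refl)
  also have "\<dots> \<le> opt_value D (Suc n) (y, t) + reward D (y, t) d"
    by (intro add_right_mono opt_value_Suc_ge[OF lin A])
  finally show ?case .
qed

section \<open>The myopic policy\<close>

lemma opt_value_le_twice_myopic:
  assumes lin: "linear_decaying_sdp D" and "myopic D \<pi>"
    and "s \<in> states D" and "snd s + n \<le> horizon D"
  shows "opt_value D n s \<le> 2 * policy_value D \<pi> n s"
  using assms(3,4)
proof (induction n arbitrary: s)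
  case (Suc n)
  obtain x t where s: "s = (x, t)" by (cases s)
  have t: "t + 1 + n \<le> horizon D" using Suc.prems s by simp
  have pol: "\<pi> \<in> policies D" using assms(2) by (simp add: myopic_def)
  have G: "\<pi> s \<in> activities D" by (rule policy_activity[OF pol Suc.prems(1)])
  obtain A where A: "A \<in> activities D" and V: "opt_value D (Suc n) s =
      measure_pmf.expectation (depletion D s A)
        (\<lambda>X. reward D s X + opt_value D n (next_state s X))"
    using opt_value_Suc_attained[OF lin] by blast
  note fin = finite_set_depletion[OF lin]
  note int = integrable_measure_pmf_finite[OF fin]
  have restore: "(\<lambda>m. (x m - X m) + X m) = x"
    if "X \<in> set_pmf (depletion D s B)" "B \<in> activities D" for X B
    using that depletion_le[OF lin that(2)] by (auto simp: s fun_eq_iff)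
  have myop: "expected_reward D s A \<le> expected_reward D s (\<pi> s)"
    using assms(2) Suc.prems A by (auto simp: myopic_def is_arg_max_linorder)
  \<comment> \<open>Restoring the items depleted by \<open>A\<close> does not decrease the future value.\<close>
  have upper: "opt_value D n (next_state s X) \<le> opt_value D n (x, t + 1)"
    if "X \<in> set_pmf (depletion D s A)" for X
    using opt_value_mono[OF lin t, of "\<lambda>m. x m - X m" X] restore[OF that A]
    by (simp add: s next_state_def)
  \<comment> \<open>Losing the items depleted by the myopic activity costs at most the reward they have just earned.\<close>
  have lower: "opt_value D n (x, t + 1) \<le> opt_value D n (next_state s X) + reward D s X"
    if "X \<in> set_pmf (depletion D s (\<pi> s))" for X
  proof -
    have "opt_value D n (x, t + 1) \<le> opt_value D n (next_state s X) + reward D (x, t + 1) X"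
      using opt_value_add_le[OF lin t, of "\<lambda>m. x m - X m" X] restore[OF that G]
      by (simp add: s next_state_def reward_def)
    moreover have "reward D (x, t + 1) X \<le> reward D s X"
      using t unfolding s by (intro reward_antimono lin) simp
    ultimately show ?thesis by simp
  qed
  have IH: "opt_value D n (next_state s X) \<le> 2 * policy_value D \<pi> n (next_state s X)" for X
    using Suc.prems
    by (intro Suc.IH next_state_in_states) (auto simp: next_state_def split: prod.splits)
  have "opt_value D (Suc n) s \<le>
      measure_pmf.expectation (depletion D s A) (\<lambda>X. reward D s X + opt_value D n (x, t + 1))"
    unfolding V by (intro expectation_mono_finite fin A add_left_mono upper)
  also have "\<dots> = expected_reward D s A + opt_value D n (x, t + 1)"
    unfolding expected_reward_def
    by (subst Bochner_Integration.integral_add) (simp_all add: int A)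
  also have "\<dots> \<le> expected_reward D s (\<pi> s) + opt_value D n (x, t + 1)"
    using myop by simp
  also have "\<dots> = measure_pmf.expectation (depletion D s (\<pi> s))
      (\<lambda>X. reward D s X + opt_value D n (x, t + 1))"
    unfolding expected_reward_def
    by (subst Bochner_Integration.integral_add) (simp_all add: int G)
  also have "\<dots> \<le> measure_pmf.expectation (depletion D s (\<pi> s))
      (\<lambda>X. 2 * (reward D s X + policy_value D \<pi> n (next_state s X)))"
  proof (intro expectation_mono_finite fin G)
    fix X assume "X \<in> set_pmf (depletion D s (\<pi> s))"
    then show "reward D s X + opt_value D n (x, t + 1) \<le>
        2 * (reward D s X + policy_value D \<pi> n (next_state s X))"
      using lower[of X] IH[of X] by simp
  qed
  also have "\<dots> = 2 * policy_value D \<pi> (Suc n) s"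
    by (simp only: policy_value_Suc[OF lin pol Suc.prems] integral_mult_right_zero)
  finally show ?case .
qed simp

theorem mainTheorem8:
  fixes D :: "'a sdp" and \<pi>g :: "'a policy" and s :: state
  assumes "linear_decaying_sdp D"
    and "myopic D \<pi>g"
    and "s \<in> states D"
  shows "J_opt D s \<le> 2 * J D \<pi>g s"
proof -
  let ?n = "horizon D - snd s"
  have n: "snd s + ?n \<le> horizon D"
    using assms(3) by (auto simp: states_def)
  have "J D \<pi> s \<le> 2 * J D \<pi>g s" if "\<pi> \<in> policies D" for \<pi>
    using policy_value_le_opt_value[OF assms(1) that assms(3) n]
      opt_value_le_twice_myopic[OF assms n]
    unfolding J_eq_policy_value by linarith
  then show ?thesis
    using assms(1) finite_policies[of D] policies_nonempty[of D]
    unfolding J_opt_def linear_decaying_sdp_def by simp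
qed

end
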